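(* For every coherent configuration $(X,S)$, the associated Frobenius structure $(S,\nabla,e,\Delta,e^\dagger)$ in $\mathbf{Mat}_{\mathbb R_0^+}$ is (a) special if and only if $(X,S)$ is thin; (b) symmetric if and only if $(X,S)$ is $\frac12$-homogeneous; (c) extra if and only if $(X,S)$ is an association scheme.
   Context: $\mathbf{Mat}_{\mathbb R_0^+}$ is the category whose objects are finite sets and whose morphisms $f\colon X\to Y$ are matrices $(f_x^y)_{x\in X,y\in Y}$ of non-negative reals, with composition $(g\circ f)_a^c=\sum_{b}f_a^b g_b^c$. It is symmetric monoidal with $X\otimes Y=X\times Y$, $(f\otimes g)_{ac}^{bd}=f_a^b g_c^d$, unit object $I=\{*\}$, symmetry $\sigma$; $f^\dagger$ is the transpose of $f$. A coherent configuration $(X,S)$ is a finite set $X$ with a partition $S$ of $X\times X$ such that: if $p\in S$ contains some $(x,x)$ then $p\subseteq\mathrm{id}_X$; for $a,b,c\in S$ the number $\nabla_{ab}^c$ of $z\in X$ with $(x,z)\in a$, $(z,y)\in b$ is the same for all $(x,y)\in c$; and $c\in S$ implies $c^{-1}=\{(y,x):(x,y)\in c\}\in S$. Elements of $S$ are colors; $E_S=\{p\in S:p\subseteq \mathrm{id}_X\}$ is the set of unit colors. For $a\in S$ the source $s(a)$ is the unique $q\in E_S$ with $\nabla_{aa^{-1}}^q>0$, and the valency is $\|a\|=\nabla_{aa^{-1}}^{s(a)}$ (the number of $y$ with $(x,y)\in a$, for any $x$ for which such a $y$ exists). $(X,S)$ is thin if $\|a\|=1$ for all $a\in S$; $\frac12$-homogeneous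 if all unit colors have the same cardinality as subsets of $X\times X$; an association scheme if $\mathrm{id}_X\in S$. The Frobenius structure associated with $(X,S)$ consists of the monoid $(S,\nabla,e)$, where $\nabla\colon S\otimes S\to S$ is the matrix of the $\nabla_{ab}^c$ and $e\colon I\to S$ has $e_*^a=1$ if $a\in E_S$, $0$ otherwise, together with the comonoid $(S,\Delta,e^\dagger)$ with $\Delta_a^{bc}=\frac{1}{\|b^{-1}\|}\nabla_{b^{-1}a}^c$ (which equals $\frac{1}{\|c\|}\nabla_{ac^{-1}}^b$). A Frobenius structure with multiplication $\nabla$, unit $e$, comultiplication $\Delta$, counit $c$ on $S$ is special if $\nabla\circ\Delta=t\cdot\mathrm{id}_S$ for some scalar $t\in\mathbb R_0^+$; symmetric if $c\circ\nabla\circ\sigma_{S,S}=c\circ\nabla$; extra if $c\circ e=\mathrm{id}_I$. *)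

theory Defs
  imports Complex_Main "HOL-Library.Disjoint_Sets"
begin

section \<open>Matrices of non-negative reals between finite sets\<close>

text \<open>
  A morphism \<open>X \<rightarrow> Y\<close> is a function \<open>f\<close> where \<open>f x y\<close> is the entry with lower index \<open>x\<close> and upper
  index \<open>y\<close>.  It is required to vanish outside \<open>X \<times> Y\<close>, so that equality of morphisms with the same
  source and target is equality of functions.
\<close>

definition mat_hom :: "'a set \<Rightarrow> 'b set \<Rightarrow> ('a \<Rightarrow> 'b \<Rightarrow> real) set" where
  "mat_hom X Y = {f. (\<forall>x y. 0 \<le> f x y) \<and> (\<forall>x y. x \<notin> X \<or> y \<notin> Y \<longrightarrow> f x y = 0)}"

text \<open>\<open>mat_comp Y g f\<close> is \<open>g \<circ> f\<close> for \<open>f: X \<rightarrow> Y\<close> and \<open>g: Y \<rightarrow> Z\<close>.\<close>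

definition mat_comp ::
    "'b set \<Rightarrow> ('b \<Rightarrow> 'c \<Rightarrow> real) \<Rightarrow> ('a \<Rightarrow> 'b \<Rightarrow> real) \<Rightarrow> 'a \<Rightarrow> 'c \<Rightarrow> real" where
  "mat_comp Y g f = (\<lambda>a c. \<Sum>b\<in>Y. f a b * g b c)"

definition mat_tensor ::
    "('a \<Rightarrow> 'b \<Rightarrow> real) \<Rightarrow> ('c \<Rightarrow> 'd \<Rightarrow> real) \<Rightarrow> 'a \<times> 'c \<Rightarrow> 'b \<times> 'd \<Rightarrow> real" where
  "mat_tensor f g = (\<lambda>(a, c) (b, d). f a b * g c d)"

definition mat_dagger :: "('a \<Rightarrow> 'b \<Rightarrow> real) \<Rightarrow> 'b \<Rightarrow> 'a \<Rightarrow> real" where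
  "mat_dagger f = (\<lambda>y x. f x y)"

definition mat_scale :: "real \<Rightarrow> ('a \<Rightarrow> 'b \<Rightarrow> real) \<Rightarrow> 'a \<Rightarrow> 'b \<Rightarrow> real" where
  "mat_scale t f = (\<lambda>x y. t * f x y)"

definition mat_of_fun :: "'a set \<Rightarrow> ('a \<Rightarrow> 'b) \<Rightarrow> 'a \<Rightarrow> 'b \<Rightarrow> real" where
  "mat_of_fun X h = (\<lambda>x y. if x \<in> X \<and> y = h x then 1 else 0)"

definition mat_id :: "'a set \<Rightarrow> 'a \<Rightarrow> 'a \<Rightarrow> real" where
  "mat_id X = mat_of_fun X (\<lambda>x. x)"

definition mat_sym :: "'a set \<Rightarrow> 'b set \<Rightarrow> 'a \<times> 'b \<Rightarrow> 'b \<times> 'a \<Rightarrow> real" where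
  "mat_sym X Y = mat_of_fun (X \<times> Y) (\<lambda>(x, y). (y, x))"

definition mat_assoc ::
    "'a set \<Rightarrow> 'b set \<Rightarrow> 'c set \<Rightarrow> ('a \<times> 'b) \<times> 'c \<Rightarrow> 'a \<times> 'b \<times> 'c \<Rightarrow> real" where
  "mat_assoc X Y Z = mat_of_fun ((X \<times> Y) \<times> Z) (\<lambda>((x, y), z). (x, y, z))"

text \<open>The unit object \<open>I\<close> is \<^term>\<open>UNIV :: unit set\<close>.\<close>

definition mat_lunit :: "'a set \<Rightarrow> unit \<times> 'a \<Rightarrow> 'a \<Rightarrow> real" where
  "mat_lunit X = mat_of_fun (UNIV \<times> X) snd"

definition mat_runit :: "'a set \<Rightarrow> 'a \<times> unit \<Rightarrow> 'a \<Rightarrow> real" where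
  "mat_runit X = mat_of_fun (X \<times> UNIV) fst"


section \<open>Frobenius structures\<close>

record 'a frobenius_data =
  Obj :: "'a set"
  Mult :: "'a \<times> 'a \<Rightarrow> 'a \<Rightarrow> real"
  Unit :: "unit \<Rightarrow> 'a \<Rightarrow> real"
  Comult :: "'a \<Rightarrow> 'a \<times> 'a \<Rightarrow> real"
  Counit :: "'a \<Rightarrow> unit \<Rightarrow> real"

definition frobenius_structure :: "'a frobenius_data \<Rightarrow> bool" where
  "frobenius_structure F \<longleftrightarrow>
    (let A = Obj F; m = Mult F; e = Unit F; d = Comult F; c = Counit F; i = mat_id A;
         A2 = A \<times> A; \<alpha> = mat_assoc A A A in
      finite A \<and> m \<in> mat_hom A2 A \<and> e \<in> mat_hom UNIV A \<and>
      d \<in> mat_hom A A2 \<and> c \<in> mat_hom A UNIV \<and>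
      \<comment> \<open>monoid\<close>
      mat_comp A2 m (mat_tensor m i) =
        mat_comp A2 m (mat_comp (A \<times> A2) (mat_tensor i m) \<alpha>) \<and>
      mat_comp A2 m (mat_tensor e i) = mat_lunit A \<and>
      mat_comp A2 m (mat_tensor i e) = mat_runit A \<and>
      \<comment> \<open>comonoid\<close>
      mat_comp (A2 \<times> A) \<alpha> (mat_comp A2 (mat_tensor d i) d) =
        mat_comp A2 (mat_tensor i d) d \<and>
      mat_comp (UNIV \<times> A) (mat_lunit A) (mat_comp A2 (mat_tensor c i) d) = i \<and>
      mat_comp (A \<times> UNIV) (mat_runit A) (mat_comp A2 (mat_tensor i c) d) = i \<and>
      \<comment> \<open>Frobenius law\<close>
      mat_comp (A \<times> A2) (mat_tensor i m) (mat_comp (A2 \<times> A) \<alpha> (mat_tensor d i)) =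
        mat_comp A d m \<and>
      mat_comp (A2 \<times> A) (mat_tensor m i) (mat_comp (A \<times> A2) (mat_dagger \<alpha>) (mat_tensor i d)) =
        mat_comp A d m)"

definition special :: "'a frobenius_data \<Rightarrow> bool" where
  "special F \<longleftrightarrow>
    (\<exists>t\<ge>0. mat_comp (Obj F \<times> Obj F) (Mult F) (Comult F) = mat_scale t (mat_id (Obj F)))"

definition symmetric :: "'a frobenius_data \<Rightarrow> bool" where
  "symmetric F \<longleftrightarrow>
    mat_comp (Obj F \<times> Obj F) (mat_comp (Obj F) (Counit F) (Mult F)) (mat_sym (Obj F) (Obj F)) =
      mat_comp (Obj F) (Counit F) (Mult F)"

definition extra :: "'a frobenius_data \<Rightarrow> bool" where
  "extra F \<longleftrightarrow> mat_comp (Obj F) (Counit F) (Unit F) = mat_id UNIV"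


section \<open>Coherent configurations\<close>

locale coherent_configuration =
  fixes X :: "'a set" and S :: "'a rel set"
  assumes finite_X: "finite X"
    and partition: "partition_on (X \<times> X) S"
    and diagonal: "p \<in> S \<Longrightarrow> (x, x) \<in> p \<Longrightarrow> p \<subseteq> Id_on X"
    and regular: "a \<in> S \<Longrightarrow> b \<in> S \<Longrightarrow> c \<in> S \<Longrightarrow> (x, y) \<in> c \<Longrightarrow> (x', y') \<in> c \<Longrightarrow>
      card {z\<in>X. (x, z) \<in> a \<and> (z, y) \<in> b} = card {z\<in>X. (x', z) \<in> a \<and> (z, y') \<in> b}"
    and converse_closed: "c \<in> S \<Longrightarrow> c\<inverse> \<in> S"

definition intersection_number :: "'a set \<Rightarrow> 'a rel \<Rightarrow> 'a rel \<Rightarrow> 'a rel \<Rightarrow> nat" where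
  "intersection_number X a b c =
    (THE n. \<forall>(x, y)\<in>c. card {z\<in>X. (x, z) \<in> a \<and> (z, y) \<in> b} = n)"

definition unit_colors :: "'a set \<Rightarrow> 'a rel set \<Rightarrow> 'a rel set" where
  "unit_colors X S = {p \<in> S. p \<subseteq> Id_on X}"

definition color_source :: "'a set \<Rightarrow> 'a rel set \<Rightarrow> 'a rel \<Rightarrow> 'a rel" where
  "color_source X S a = (THE q. q \<in> unit_colors X S \<and> intersection_number X a (a\<inverse>) q > 0)"

definition valency :: "'a set \<Rightarrow> 'a rel set \<Rightarrow> 'a rel \<Rightarrow> nat" where
  "valency X S a = intersection_number X a (a\<inverse>) (color_source X S a)"

definition thin :: "'a set \<Rightarrow> 'a rel set \<Rightarrow> bool" where
  "thin X S \<longleftrightarrow> (\<forall>a\<in>S. valency X S a = 1)"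

definition half_homogeneous :: "'a set \<Rightarrow> 'a rel set \<Rightarrow> bool" where
  "half_homogeneous X S \<longleftrightarrow> (\<forall>p\<in>unit_colors X S. \<forall>q\<in>unit_colors X S. card p = card q)"

definition association_scheme :: "'a set \<Rightarrow> 'a rel set \<Rightarrow> bool" where
  "association_scheme X S \<longleftrightarrow> Id_on X \<in> S"


section \<open>The associated Frobenius structure\<close>

definition config_mult :: "'a set \<Rightarrow> 'a rel set \<Rightarrow> 'a rel \<times> 'a rel \<Rightarrow> 'a rel \<Rightarrow> real" where
  "config_mult X S = (\<lambda>(a, b) c.
    if a \<in> S \<and> b \<in> S \<and> c \<in> S then real (intersection_number X a b c) else 0)"

definition config_unit :: "'a set \<Rightarrow> 'a rel set \<Rightarrow> unit \<Rightarrow> 'a rel \<Rightarrow> real" where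
  "config_unit X S = (\<lambda>_ a. if a \<in> unit_colors X S then 1 else 0)"

definition config_comult :: "'a set \<Rightarrow> 'a rel set \<Rightarrow> 'a rel \<Rightarrow> 'a rel \<times> 'a rel \<Rightarrow> real" where
  "config_comult X S = (\<lambda>a (b, c).
    if a \<in> S \<and> b \<in> S \<and> c \<in> S
    then 1 / real (valency X S (b\<inverse>)) * real (intersection_number X (b\<inverse>) a c) else 0)"

definition config_frobenius :: "'a set \<Rightarrow> 'a rel set \<Rightarrow> 'a rel frobenius_data" where
  "config_frobenius X S =
    \<lparr>Obj = S, Mult = config_mult X S, Unit = config_unit X S,
     Comult = config_comult X S, Counit = mat_dagger (config_unit X S)\<rparr>"


section \<open>The Frobenius axioms hold\<close>

text \<open>
  The predicates \<open>special\<close>, \<open>symmetric\<close> and \<open>extra\<close> only refer to the data of a Frobenius structure;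
  \<open>config_frobenius_structure\<close> below shows that the data associated with a coherent configuration
  satisfies the axioms.
\<close>

context coherent_configuration
begin

lemma color_subset: "a \<in> S \<Longrightarrow> a \<subseteq> X \<times> X"
  using partition unfolding partition_on_def by blast

lemma color_nonempty: assumes "a \<in> S" obtains x y where "(x, y) \<in> a"
  using partition assms unfolding partition_on_def by (metis equals0I surj_pair)

lemma color_unique: "a \<in> S \<Longrightarrow> b \<in> S \<Longrightarrow> u \<in> a \<Longrightarrow> u \<in> b \<Longrightarrow> a = b"
  using partition unfolding partition_on_def disjoint_def by blast

lemma color_exists: assumes "x \<in> X" "y \<in> X" obtains a where "a \<in> S" "(x, y) \<in> a"
  using partition assms unfolding partition_on_def by blast

lemma finite_S: "finite S"
  using finite_elements[OF _ partition] finite_X by simp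

abbreviation "N \<equiv> intersection_number X"
abbreviation "E \<equiv> unit_colors X S"
abbreviation "v \<equiv> valency X S"

lemma N_eq:
  assumes "a \<in> S" "b \<in> S" "c \<in> S" "(x, y) \<in> c"
  shows "N a b c = card {z\<in>X. (x, z) \<in> a \<and> (z, y) \<in> b}"
  unfolding intersection_number_def
proof (rule the_equality)
  show "\<forall>(x', y')\<in>c. card {z\<in>X. (x', z) \<in> a \<and> (z, y') \<in> b} =
      card {z\<in>X. (x, z) \<in> a \<and> (z, y) \<in> b}"
    using regular[OF assms(1-3) _ assms(4)] by blast
qed (use assms(4) in auto)

lemma N_sum:
  assumes "a \<in> S" "b \<in> S" "c \<in> S" "(x, y) \<in> c"
  shows "real (N a b c) = (\<Sum>z\<in>X. of_bool ((x, z) \<in> a) * of_bool ((z, y) \<in> b))"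
proof -
  have "(\<Sum>z\<in>X. of_bool ((x, z) \<in> a) * of_bool ((z, y) \<in> b) :: real) =
      (\<Sum>z\<in>X. of_bool ((x, z) \<in> a \<and> (z, y) \<in> b))"
    by (rule sum.cong) auto
  also have "\<dots> = real (card {z\<in>X. (x, z) \<in> a \<and> (z, y) \<in> b})"
    using finite_X by (simp add: of_bool_def sum.If_cases Int_def)
  finally show ?thesis by (simp add: N_eq[OF assms])
qed

lemma sum_colors:
  assumes "x \<in> X" "y \<in> X" "a \<in> S" "(x, y) \<in> a"
  shows "(\<Sum>d\<in>S. of_bool ((x, y) \<in> d) * f d) = (f a :: real)"
proof -
  have "(\<Sum>d\<in>S. of_bool ((x, y) \<in> d) * f d) = (\<Sum>d\<in>S. if d = a then f d else 0)"
  proof (rule sum.cong[OF refl])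
    fix d assume "d \<in> S"
    then have "(x, y) \<in> d \<longleftrightarrow> d = a" using color_unique[OF _ assms(3) _ assms(4)] assms(4) by blast
    then show "of_bool ((x, y) \<in> d) * f d = (if d = a then f d else 0)" by simp
  qed
  then show ?thesis using finite_S assms(3) by simp
qed

lemma N_assoc:
  assumes "a \<in> S" "b \<in> S" "c \<in> S" "e \<in> S"
  shows "(\<Sum>d\<in>S. real (N a b d) * real (N d c e)) = (\<Sum>d\<in>S. real (N b c d) * real (N a d e))"
proof -
  obtain x y where xy: "(x, y) \<in> e" using color_nonempty assms(4) by blast
  then have X: "x \<in> X" "y \<in> X" using color_subset assms(4) by auto
  have "(\<Sum>d\<in>S. real (N a b d) * real (N d c e)) =
      (\<Sum>d\<in>S. \<Sum>w\<in>X. of_bool ((w, y) \<in> c) * (of_bool ((x, w) \<in> d) * real (N a b d)))"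
    by (intro sum.cong refl) (simp add: N_sum[OF _ _ _ xy] assms sum_distrib_left mult_ac)
  also have "\<dots> = (\<Sum>w\<in>X. of_bool ((w, y) \<in> c) * (\<Sum>d\<in>S. of_bool ((x, w) \<in> d) * real (N a b d)))"
    by (subst sum.swap) (simp add: sum_distrib_left)
  also have "\<dots> = (\<Sum>w\<in>X. of_bool ((w, y) \<in> c) *
      (\<Sum>z\<in>X. of_bool ((x, z) \<in> a) * of_bool ((z, w) \<in> b)))"
  proof (intro sum.cong refl)
    fix w assume w: "w \<in> X"
    obtain g where g: "g \<in> S" "(x, w) \<in> g" using color_exists[OF X(1) w] .
    show "of_bool ((w, y) \<in> c) * (\<Sum>d\<in>S. of_bool ((x, w) \<in> d) * real (N a b d)) =
      of_bool ((w, y) \<in> c) * (\<Sum>z\<in>X. of_bool ((x, z) \<in> a) * of_bool ((z, w) \<in> b))"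
      by (simp only: sum_colors[OF X(1) w g] N_sum[OF assms(1,2) g])
  qed
  also have "\<dots> = (\<Sum>z\<in>X. of_bool ((x, z) \<in> a) *
      (\<Sum>w\<in>X. of_bool ((z, w) \<in> b) * of_bool ((w, y) \<in> c)))"
    by (simp only: sum_distrib_left, subst sum.swap) (simp only: mult_ac)
  also have "\<dots> = (\<Sum>z\<in>X. of_bool ((x, z) \<in> a) * (\<Sum>d\<in>S. of_bool ((z, y) \<in> d) * real (N b c d)))"
  proof (intro sum.cong refl)
    fix z assume z: "z \<in> X"
    obtain g where g: "g \<in> S" "(z, y) \<in> g" using color_exists[OF z X(2)] .
    show "of_bool ((x, z) \<in> a) * (\<Sum>w\<in>X. of_bool ((z, w) \<in> b) * of_bool ((w, y) \<in> c)) =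
      of_bool ((x, z) \<in> a) * (\<Sum>d\<in>S. of_bool ((z, y) \<in> d) * real (N b c d))"
      by (simp only: sum_colors[OF z X(2) g] N_sum[OF assms(2,3) g])
  qed
  also have "\<dots> = (\<Sum>d\<in>S. \<Sum>z\<in>X. of_bool ((x, z) \<in> a) * (of_bool ((z, y) \<in> d) * real (N b c d)))"
    by (subst sum.swap) (simp add: sum_distrib_left)
  also have "\<dots> = (\<Sum>d\<in>S. real (N b c d) * real (N a d e))"
    by (intro sum.cong refl) (simp add: N_sum[OF _ _ _ xy] assms sum_distrib_left mult_ac)
  finally show ?thesis .
qed

lemma unit_color_iff: "q \<in> S \<Longrightarrow> (x, x) \<in> q \<Longrightarrow> q \<in> E"
  using diagonal by (auto simp: unit_colors_def)

lemma unit_color_subset: "q \<in> E \<Longrightarrow> q \<subseteq> Id_on X" "q \<in> E \<Longrightarrow> q \<in> S"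
  by (auto simp: unit_colors_def)

lemma N_left_unit_gen:
  assumes "a \<in> S" "c \<in> S"
  shows "(\<Sum>q\<in>S. of_bool (q \<in> E) * real (N q a c)) = of_bool (a = c)"
proof -
  obtain x y where xy: "(x, y) \<in> c" using color_nonempty assms(2) by blast
  then have X: "x \<in> X" "y \<in> X" using color_subset assms(2) by auto
  obtain g where g: "g \<in> S" "(x, x) \<in> g" using color_exists[OF X(1) X(1)] .
  have "of_bool (q \<in> E) * real (N q a c) = of_bool ((x, x) \<in> q) * of_bool (a = c)"
    if q: "q \<in> S" for q
  proof -
    have ac: "(x, y) \<in> a \<longleftrightarrow> a = c" using color_unique[OF assms _ xy] xy by blast
    show ?thesis
    proof (cases "q \<in> E")
      case True
      have sub: "(x, z) \<in> q \<longleftrightarrow> z = x \<and> (x, x) \<in> q" for z using unit_color_subset(1)[OF True] by blast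
      have "{z \<in> X. (x, z) \<in> q \<and> (z, y) \<in> a} = {z. z = x \<and> (x, x) \<in> q \<and> a = c}"
        by (rule set_eqI) (use sub X ac in \<open>metis (mono_tags, lifting) mem_Collect_eq\<close>)
      then show ?thesis using True N_eq[OF q assms xy] by simp
    next
      case False
      then show ?thesis using unit_color_iff[OF q] by auto
    qed
  qed
  then show ?thesis using sum_colors[OF X(1) X(1) g, of "\<lambda>_. of_bool (a = c)"] by simp
qed

lemma N_right_unit_gen:
  assumes "a \<in> S" "c \<in> S"
  shows "(\<Sum>q\<in>S. of_bool (q \<in> E) * real (N a q c)) = of_bool (a = c)"
proof -
  obtain x y where xy: "(x, y) \<in> c" using color_nonempty assms(2) by blast
  then have X: "x \<in> X" "y \<in> X" using color_subset assms(2) by auto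
  obtain g where g: "g \<in> S" "(y, y) \<in> g" using color_exists[OF X(2) X(2)] .
  have "of_bool (q \<in> E) * real (N a q c) = of_bool ((y, y) \<in> q) * of_bool (a = c)"
    if q: "q \<in> S" for q
  proof -
    have ac: "(x, y) \<in> a \<longleftrightarrow> a = c" using color_unique[OF assms _ xy] xy by blast
    show ?thesis
    proof (cases "q \<in> E")
      case True
      have sub: "(z, y) \<in> q \<longleftrightarrow> z = y \<and> (y, y) \<in> q" for z using unit_color_subset(1)[OF True] by blast
      have "{z \<in> X. (x, z) \<in> a \<and> (z, y) \<in> q} = {z. z = y \<and> (y, y) \<in> q \<and> a = c}"
        by (rule set_eqI) (use sub X ac in \<open>metis (mono_tags, lifting) mem_Collect_eq\<close>)
      then show ?thesis using True N_eq[OF assms(1) q assms(2) xy] by simp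
    next
      case False
      then show ?thesis using unit_color_iff[OF q] by auto
    qed
  qed
  then show ?thesis using sum_colors[OF X(2) X(2) g, of "\<lambda>_. of_bool (a = c)"] by simp
qed

lemma color_source_unique:
  assumes "a \<in> S" "q \<in> E" "(x, x) \<in> q" "(x, y) \<in> a"
    "q' \<in> E" "(x', x') \<in> q'" "(x', y') \<in> a"
  shows "q' = q"
proof -
  have q: "q \<in> S" "q' \<in> S" using assms unit_color_subset by auto
  have X: "x \<in> X" using assms color_subset by auto
  have "{z\<in>X. (x, z) \<in> q \<and> (z, y) \<in> a} = {x}"
    using unit_color_subset(1)[OF assms(2)] X assms by auto
  then have "card {z\<in>X. (x', z) \<in> q \<and> (z, y') \<in> a} = 1"
    using regular[OF q(1) assms(1) assms(1) assms(4,7)] by simp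
  then have "{z\<in>X. (x', z) \<in> q \<and> (z, y') \<in> a} \<noteq> {}" by (metis card.empty zero_neq_one)
  then have "(x', x') \<in> q" using unit_color_subset(1)[OF assms(2)] by auto
  then show ?thesis using color_unique[OF q(2,1) assms(6)] by blast
qed

lemma color_source_eq:
  assumes "a \<in> S" "q \<in> E" "(x, x) \<in> q" "(x, y) \<in> a"
  shows "color_source X S a = q"
  unfolding color_source_def
proof (rule the_equality)
  note a' = converse_closed[OF assms(1)]
  have q: "q \<in> S" using assms(2) by (rule unit_color_subset)
  have "y \<in> X" using assms(4) color_subset[OF assms(1)] by blast
  then have "y \<in> {z\<in>X. (x, z) \<in> a \<and> (z, x) \<in> a\<inverse>}" using assms(4) by blast
  then have "card {z\<in>X. (x, z) \<in> a \<and> (z, x) \<in> a\<inverse>} > 0"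
    using card_gt_0_iff finite_X by fastforce
  then have "N a (a\<inverse>) q > 0" by (simp only: N_eq[OF assms(1) a' q assms(3)])
  then show "q \<in> E \<and> N a (a\<inverse>) q > 0" using assms(2) by simp
  fix q' assume q': "q' \<in> E \<and> N a (a\<inverse>) q' > 0"
  then have q'S: "q' \<in> S" using unit_color_subset(2) by blast
  then obtain x' w where x'w: "(x', w) \<in> q'" using color_nonempty by blast
  moreover have "w = x'" using q' unit_color_subset(1)[of q'] x'w by blast
  ultimately have x': "(x', x') \<in> q'" by simp
  have "card {z\<in>X. (x', z) \<in> a \<and> (z, x') \<in> a\<inverse>} > 0"
    using q' by (simp only: N_eq[OF assms(1) a' q'S x'])
  then obtain y' where y': "(x', y') \<in> a" by (subst (asm) card_gt_0_iff) blast
  show "q' = q" using q' by (intro color_source_unique[OF assms _ x' y']) simp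
qed

lemma valency_eq:
  assumes "a \<in> S" "(x, y) \<in> a"
  shows "v a = card {z\<in>X. (x, z) \<in> a}"
proof -
  have X: "x \<in> X" using assms color_subset by auto
  obtain q where q: "q \<in> S" "(x, x) \<in> q" using color_exists[OF X X] .
  then have "color_source X S a = q"
    using color_source_eq[OF assms(1) unit_color_iff[OF q] q(2) assms(2)] by simp
  then show ?thesis unfolding valency_def
    using N_eq[OF assms(1) converse_closed[OF assms(1)] q] by simp
qed

lemma valency_pos: assumes "a \<in> S" shows "v a > 0"
proof -
  obtain x y where xy: "(x, y) \<in> a" using color_nonempty assms by blast
  then have "y \<in> {z\<in>X. (x, z) \<in> a}" using color_subset assms by auto
  then show ?thesis using valency_eq[OF assms xy] finite_X by (auto simp: card_gt_0_iff)
qed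

lemma finite_color: "a \<in> S \<Longrightarrow> finite a"
  by (rule finite_subset[OF color_subset]) (simp_all add: finite_X)

lemma card_triangles:
  assumes "a \<in> S" "b \<in> S" "c \<in> S"
  shows "card {(x, z, y). (x, z) \<in> a \<and> (z, y) \<in> b \<and> (x, y) \<in> c} = card c * N a b c"
proof -
  have "card (SIGMA p:c. {z\<in>X. (fst p, z) \<in> a \<and> (z, snd p) \<in> b}) = card c * N a b c"
  proof -
    have "(\<Sum>p\<in>c. card {z\<in>X. (fst p, z) \<in> a \<and> (z, snd p) \<in> b}) = (\<Sum>p\<in>c. N a b c)"
    proof (rule sum.cong[OF refl])
      fix p assume "p \<in> c"
      then have "(fst p, snd p) \<in> c" by simp
      from N_eq[OF assms this]
      show "card {z\<in>X. (fst p, z) \<in> a \<and> (z, snd p) \<in> b} = N a b c" by (rule sym)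
    qed
    then show ?thesis using finite_X finite_color[OF assms(3)] by (subst card_SigmaI) auto
  qed
  moreover have "bij_betw (\<lambda>((x, y), z). (x, z, y))
     (SIGMA p:c. {z\<in>X. (fst p, z) \<in> a \<and> (z, snd p) \<in> b})
     {(x, z, y). (x, z) \<in> a \<and> (z, y) \<in> b \<and> (x, y) \<in> c}"
    by (rule bij_betwI[where g = "\<lambda>(x, z, y). ((x, y), z)"])
      (use color_subset[OF assms(1)] in auto)
  ultimately show ?thesis using bij_betw_same_card by fastforce
qed

lemma N_rotate_right:
  assumes "a \<in> S" "b \<in> S" "c \<in> S"
  shows "card c * N a b c = card a * N c (b\<inverse>) a"
proof -
  have "bij_betw (\<lambda>(x, z, y). (x, y, z))
     {(x, z, y). (x, z) \<in> a \<and> (z, y) \<in> b \<and> (x, y) \<in> c}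
     {(x, z, y). (x, z) \<in> c \<and> (z, y) \<in> b\<inverse> \<and> (x, y) \<in> a}"
    by (rule bij_betwI[where g = "\<lambda>(x, z, y). (x, y, z)"]) auto
  from bij_betw_same_card[OF this] show ?thesis
    by (simp only: card_triangles[OF assms]
        card_triangles[OF assms(3) converse_closed[OF assms(2)] assms(1)])
qed

lemma N_rotate_left:
  assumes "a \<in> S" "b \<in> S" "c \<in> S"
  shows "card c * N a b c = card b * N (a\<inverse>) c b"
proof -
  have "bij_betw (\<lambda>(x, z, y). (z, x, y))
     {(x, z, y). (x, z) \<in> a \<and> (z, y) \<in> b \<and> (x, y) \<in> c}
     {(x, z, y). (x, z) \<in> a\<inverse> \<and> (z, y) \<in> c \<and> (x, y) \<in> b}"
    by (rule bij_betwI[where g = "\<lambda>(x, z, y). (z, x, y)"]) auto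
  from bij_betw_same_card[OF this] show ?thesis
    by (simp only: card_triangles[OF assms]
        card_triangles[OF converse_closed[OF assms(1)] assms(3,2)])
qed

lemma card_source_valency:
  assumes "a \<in> S" "q \<in> E" "(x, x) \<in> q" "(x, y) \<in> a"
  shows "card a = card q * v a"
proof -
  have q: "q \<in> S" using assms(2) by (rule unit_color_subset)
  have "color_source X S a = q" using color_source_eq[OF assms] .
  then have "card q * v a = card q * N a (a\<inverse>) q" by (simp add: valency_def)
  also have "\<dots> = card a * N q a a"
    using N_rotate_right[OF assms(1) converse_closed[OF assms(1)] q] by simp
  also have "N q a a = card {x}"
  proof -
    have "{z\<in>X. (x, z) \<in> q \<and> (z, y) \<in> a} = {x}"
      using unit_color_subset(1)[OF assms(2)] assms color_subset[OF assms(1)] by auto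
    then show ?thesis using N_eq[OF q assms(1) assms(1) assms(4)] by simp
  qed
  finally show ?thesis by simp
qed

text \<open>The two formulas for the comultiplication agree.\<close>

lemma comult_formula:
  assumes "a \<in> S" "b \<in> S" "c \<in> S"
  shows "1 / real (v (b\<inverse>)) * real (N (b\<inverse>) a c) = 1 / real (v c) * real (N a (c\<inverse>) b)"
proof -
  note cv = converse_closed
  have card_pos: "card g > 0" if "g \<in> S" for g
    using finite_color[OF that] color_nonempty[OF that] by (metis card_gt_0_iff empty_iff)
  have pos: "v (b\<inverse>) > 0" "v c > 0" "card a > 0" "card b > 0" "card c > 0"
    using valency_pos cv card_pos assms by blast+
  have 1: "card a * N b c a = card c * N (b\<inverse>) a c" using N_rotate_left assms by blast
  have 2: "card a * N b c a = card b * N a (c\<inverse>) b" using N_rotate_right assms by blast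
  show ?thesis
  proof (cases "N b c a = 0")
    case True
    with 1 2 pos show ?thesis by simp
  next
    case False
    obtain x y where xy: "(x, y) \<in> a" using color_nonempty assms(1) by blast
    have "{z\<in>X. (x, z) \<in> b \<and> (z, y) \<in> c} \<noteq> {}"
      using False N_eq[OF assms(2,3,1) xy] by (metis card.empty)
    then obtain z where z: "z \<in> X" "(x, z) \<in> b" "(z, y) \<in> c" by auto
    obtain q where q: "q \<in> S" "(z, z) \<in> q" using color_exists[OF z(1) z(1)] .
    have qE: "q \<in> E" using unit_color_iff[OF q] .
    have c: "card c = card q * v c" using card_source_valency[OF assms(3) qE q(2) z(3)] .
    have b: "card b = card q * v (b\<inverse>)"
      using card_source_valency[OF cv[OF assms(2)] qE q(2), of x] z by simp
    have "card q > 0" using c pos by (cases "card q") auto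
    moreover have "card q * v c * N (b\<inverse>) a c = card q * v (b\<inverse>) * N a (c\<inverse>) b"
      unfolding b[symmetric] c[symmetric] using 1 2 by simp
    ultimately have "v c * N (b\<inverse>) a c = v (b\<inverse>) * N a (c\<inverse>) b" by simp
    then have "real (v c) * real (N (b\<inverse>) a c) = real (v (b\<inverse>)) * real (N a (c\<inverse>) b)"
      by (simp only: of_nat_mult[symmetric])
    then show ?thesis using pos by (simp add: field_simps)
  qed
qed

lemma unit_color_converse: assumes "q \<in> E" shows "q\<inverse> = q"
  using unit_color_subset(1)[OF assms] by blast

lemma unit_color_valency: assumes "q \<in> E" shows "v q = 1"
proof -
  have q: "q \<in> S" using assms by (rule unit_color_subset)
  obtain x y where xy: "(x, y) \<in> q" using color_nonempty[OF q] by blast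
  then have "{z\<in>X. (x, z) \<in> q} = {x}" using unit_color_subset(1)[OF assms] by blast
  then show ?thesis using valency_eq[OF q xy] by simp
qed

abbreviation "D a b c \<equiv> 1 / real (v (b\<inverse>)) * real (N (b\<inverse>) a c)"

lemma comult_coassoc:
  assumes "a \<in> S" "b \<in> S" "c \<in> S" "g \<in> S"
  shows "(\<Sum>p\<in>S. D a p g * D p b c) = (\<Sum>p\<in>S. D a b p * D p c g)"
proof -
  have "(\<Sum>p\<in>S. D a p g * D p b c) =
      (\<Sum>p\<in>S. (1 / real (v g) * (1 / real (v (b\<inverse>)))) * (real (N a (g\<inverse>) p) * real (N (b\<inverse>) p c)))"
  proof (rule sum.cong[OF refl])
    fix p assume p: "p \<in> S"
    show "D a p g * D p b c = (1 / real (v g) * (1 / real (v (b\<inverse>)))) * (real (N a (g\<inverse>) p) * real (N (b\<inverse>) p c))"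
      unfolding comult_formula[OF assms(1) p assms(4)] by (simp only: mult_ac)
  qed
  also have "\<dots> = (\<Sum>p\<in>S. (1 / real (v g) * (1 / real (v (b\<inverse>)))) * (real (N (b\<inverse>) a p) * real (N p (g\<inverse>) c)))"
    by (simp only: sum_distrib_left[symmetric] N_assoc converse_closed assms)
  also have "\<dots> = (\<Sum>p\<in>S. D a b p * D p c g)"
  proof (rule sum.cong[OF refl])
    fix p assume p: "p \<in> S"
    show "(1 / real (v g) * (1 / real (v (b\<inverse>)))) * (real (N (b\<inverse>) a p) * real (N p (g\<inverse>) c)) = D a b p * D p c g"
      unfolding comult_formula[OF p assms(3,4)] by (simp only: mult_ac)
  qed
  finally show ?thesis .
qed

lemma frobenius_law_left:
  assumes "a \<in> S" "b \<in> S" "c \<in> S" "e \<in> S"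
  shows "(\<Sum>p\<in>S. D a c p * real (N p b e)) = (\<Sum>p\<in>S. real (N a b p) * D p c e)"
proof -
  have "(\<Sum>p\<in>S. D a c p * real (N p b e)) =
      1 / real (v (c\<inverse>)) * (\<Sum>p\<in>S. real (N (c\<inverse>) a p) * real (N p b e))"
    by (simp add: sum_distrib_left mult_ac)
  also have "\<dots> = 1 / real (v (c\<inverse>)) * (\<Sum>p\<in>S. real (N a b p) * real (N (c\<inverse>) p e))"
    by (simp only: N_assoc converse_closed assms)
  also have "\<dots> = (\<Sum>p\<in>S. real (N a b p) * D p c e)"
    by (simp add: sum_distrib_left mult_ac)
  finally show ?thesis .
qed

lemma frobenius_law_right:
  assumes "a \<in> S" "b \<in> S" "c \<in> S" "e \<in> S"
  shows "(\<Sum>p\<in>S. D b p e * real (N a p c)) = (\<Sum>p\<in>S. real (N a b p) * D p c e)"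
proof -
  have "(\<Sum>p\<in>S. D b p e * real (N a p c)) =
      1 / real (v e) * (\<Sum>p\<in>S. real (N b (e\<inverse>) p) * real (N a p c))"
    unfolding sum_distrib_left
  proof (rule sum.cong[OF refl])
    fix p assume p: "p \<in> S"
    show "D b p e * real (N a p c) = 1 / real (v e) * (real (N b (e\<inverse>) p) * real (N a p c))"
      unfolding comult_formula[OF assms(2) p assms(4)] by (simp only: mult_ac)
  qed
  also have "\<dots> = 1 / real (v e) * (\<Sum>p\<in>S. real (N a b p) * real (N p (e\<inverse>) c))"
    by (simp only: N_assoc converse_closed assms)
  also have "\<dots> = (\<Sum>p\<in>S. real (N a b p) * D p c e)"
    unfolding sum_distrib_left
  proof (rule sum.cong[OF refl])
    fix p assume p: "p \<in> S"
    show "1 / real (v e) * (real (N a b p) * real (N p (e\<inverse>) c)) = real (N a b p) * D p c e"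
      unfolding comult_formula[OF p assms(3,4)] by (simp only: mult_ac)
  qed
  finally show ?thesis .
qed

lemma counit_left:
  assumes "a \<in> S" "c \<in> S"
  shows "(\<Sum>p\<in>S. D a p c * of_bool (p \<in> E)) = of_bool (a = c)"
proof -
  have "(\<Sum>p\<in>S. D a p c * of_bool (p \<in> E)) = (\<Sum>p\<in>S. of_bool (p \<in> E) * real (N p a c))"
    by (intro sum.cong refl) (simp add: unit_color_valency unit_color_converse)
  then show ?thesis by (simp only: N_left_unit_gen[OF assms])
qed

lemma counit_right:
  assumes "a \<in> S" "c \<in> S"
  shows "(\<Sum>p\<in>S. D a c p * of_bool (p \<in> E)) = of_bool (a = c)"
proof -
  have "(\<Sum>p\<in>S. D a c p * of_bool (p \<in> E)) = (\<Sum>p\<in>S. of_bool (p \<in> E) * real (N a p c))"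
  proof (rule sum.cong[OF refl])
    fix p assume p: "p \<in> S"
    show "D a c p * of_bool (p \<in> E) = of_bool (p \<in> E) * real (N a p c)"
      unfolding comult_formula[OF assms p]
      by (simp add: unit_color_valency unit_color_converse)
  qed
  then show ?thesis by (simp only: N_right_unit_gen[OF assms])
qed

end

lemma mat_id_apply: "mat_id A x y = of_bool (x \<in> A \<and> y = x)"
  by (simp add: mat_id_def mat_of_fun_def)

lemma mat_comp_assoc: "mat_comp Z h (mat_comp Y g f) = mat_comp Y (mat_comp Z h g) f"
  by (intro ext) (simp add: mat_comp_def sum_distrib_left sum_distrib_right mult.assoc,
    rule sum.swap)

lemma sum_of_bool_delta:
  assumes "finite A"
  shows "(\<Sum>q\<in>A. of_bool (c \<in> A \<and> q = c) * f q) = of_bool (c \<in> A) * (f c :: real)"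
    and "(\<Sum>q\<in>A. of_bool (q \<in> A \<and> c = q) * f q) = of_bool (c \<in> A) * (f c :: real)"
proof -
  have "(\<Sum>q\<in>A. of_bool (c \<in> A \<and> q = c) * f q) = (\<Sum>q\<in>A. if q = c then f q else 0)"
    by (intro sum.cong refl) auto
  then show "(\<Sum>q\<in>A. of_bool (c \<in> A \<and> q = c) * f q) = of_bool (c \<in> A) * f c"
    using assms by simp
  have "(\<Sum>q\<in>A. of_bool (q \<in> A \<and> c = q) * f q) = (\<Sum>q\<in>A. if q = c then f q else 0)"
    by (intro sum.cong refl) auto
  then show "(\<Sum>q\<in>A. of_bool (q \<in> A \<and> c = q) * f q) = of_bool (c \<in> A) * f c"
    using assms by simp
qed

lemma comp_tensor_id:
  assumes "finite A"
  shows "mat_comp (B \<times> A) g (mat_tensor f (mat_id A)) (x, c) e =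
      of_bool (c \<in> A) * (\<Sum>p\<in>B. f x p * g (p, c) e)"
    and "mat_comp (A \<times> B) h (mat_tensor (mat_id A) f) (c, x) e =
      of_bool (c \<in> A) * (\<Sum>p\<in>B. f x p * h (c, p) e)"
    and "mat_comp (B \<times> A) (mat_tensor f' (mat_id A)) g' u (y, c) =
      of_bool (c \<in> A) * (\<Sum>p\<in>B. g' u (p, c) * f' p y)"
    and "mat_comp (A \<times> B) (mat_tensor (mat_id A) f') g'' u (c, y) =
      of_bool (c \<in> A) * (\<Sum>p\<in>B. g'' u (c, p) * f' p y)"
proof -
  note d = sum_of_bool_delta[OF assms]
  have "mat_comp (B \<times> A) g (mat_tensor f (mat_id A)) (x, c) e =
      (\<Sum>p\<in>B. \<Sum>q\<in>A. of_bool (c \<in> A \<and> q = c) * (f x p * g (p, q) e))"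
    by (simp add: mat_comp_def mat_tensor_def mat_id_apply sum.cartesian_product' mult_ac)
  then show "mat_comp (B \<times> A) g (mat_tensor f (mat_id A)) (x, c) e =
      of_bool (c \<in> A) * (\<Sum>p\<in>B. f x p * g (p, c) e)"
    by (simp only: d sum_distrib_left)
  have "mat_comp (A \<times> B) h (mat_tensor (mat_id A) f) (c, x) e =
      (\<Sum>p\<in>B. \<Sum>q\<in>A. of_bool (c \<in> A \<and> q = c) * (f x p * h (q, p) e))"
    by (subst sum.swap)
      (simp add: mat_comp_def mat_tensor_def mat_id_apply sum.cartesian_product' mult_ac)
  then show "mat_comp (A \<times> B) h (mat_tensor (mat_id A) f) (c, x) e =
      of_bool (c \<in> A) * (\<Sum>p\<in>B. f x p * h (c, p) e)"
    by (simp only: d sum_distrib_left)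
  have "mat_comp (B \<times> A) (mat_tensor f' (mat_id A)) g' u (y, c) =
      (\<Sum>p\<in>B. \<Sum>q\<in>A. of_bool (q \<in> A \<and> c = q) * (g' u (p, q) * f' p y))"
    by (simp add: mat_comp_def mat_tensor_def mat_id_apply sum.cartesian_product' mult_ac)
  then show "mat_comp (B \<times> A) (mat_tensor f' (mat_id A)) g' u (y, c) =
      of_bool (c \<in> A) * (\<Sum>p\<in>B. g' u (p, c) * f' p y)"
    by (simp only: d sum_distrib_left)
  have "mat_comp (A \<times> B) (mat_tensor (mat_id A) f') g'' u (c, y) =
      (\<Sum>p\<in>B. \<Sum>q\<in>A. of_bool (q \<in> A \<and> c = q) * (g'' u (q, p) * f' p y))"
    by (subst sum.swap)
      (simp add: mat_comp_def mat_tensor_def mat_id_apply sum.cartesian_product' mult_ac)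
  then show "mat_comp (A \<times> B) (mat_tensor (mat_id A) f') g'' u (c, y) =
      of_bool (c \<in> A) * (\<Sum>p\<in>B. g'' u (c, p) * f' p y)"
    by (simp only: d sum_distrib_left)
qed

lemma comp_of_fun:
  assumes "finite Y" "\<And>x. x \<in> X \<Longrightarrow> h x \<in> Y"
  shows "mat_comp Y g (mat_of_fun X h) x z = of_bool (x \<in> X) * g (h x) z"
proof (cases "x \<in> X")
  case True
  have "mat_comp Y g (mat_of_fun X h) x z = (\<Sum>y\<in>Y. if y = h x then g y z else 0)"
    unfolding mat_comp_def by (intro sum.cong refl) (simp add: True mat_of_fun_def)
  then show ?thesis using assms True by simp
qed (simp add: mat_comp_def mat_of_fun_def)

lemma of_fun_comp:
  assumes "finite X" "inj_on h X" "x \<in> X"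
  shows "mat_comp X (mat_of_fun X h) g u (h x) = g u x"
proof -
  have "mat_comp X (mat_of_fun X h) g u (h x) = (\<Sum>y\<in>X. if y = x then g u y else 0)"
    unfolding mat_comp_def
    by (intro sum.cong refl) (use assms in \<open>auto simp: mat_of_fun_def inj_on_eq_iff\<close>)
  then show ?thesis using assms by simp
qed

lemma of_fun_comp_0:
  assumes "z \<notin> h ` X"
  shows "mat_comp X (mat_of_fun X h) g u z = 0"
  unfolding mat_comp_def by (rule sum.neutral) (use assms in \<open>auto simp: mat_of_fun_def\<close>)

lemma comp_structural:
  assumes A: "finite A"
  shows "mat_comp (A \<times> A \<times> A) g (mat_assoc A A A) ((a, b), c) z =
      of_bool (a \<in> A \<and> b \<in> A \<and> c \<in> A) * g (a, b, c) z"
    and "mat_comp ((A \<times> A) \<times> A) (mat_assoc A A A) f u (a, b, c) =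
      of_bool (a \<in> A \<and> b \<in> A \<and> c \<in> A) * f u ((a, b), c)"
    and "mat_comp (A \<times> A \<times> A) (mat_dagger (mat_assoc A A A)) f' u ((a, b), c) =
      of_bool (a \<in> A \<and> b \<in> A \<and> c \<in> A) * f' u (a, b, c)"
    and "mat_comp (UNIV \<times> A) (mat_lunit A) fl u a = of_bool (a \<in> A) * fl u ((), a)"
    and "mat_comp (A \<times> UNIV) (mat_runit A) fr u a = of_bool (a \<in> A) * fr u (a, ())"
proof -
  have fin: "finite ((A \<times> A) \<times> A)" "finite (A \<times> A \<times> A)"
    "finite ((UNIV :: unit set) \<times> A)" "finite (A \<times> (UNIV :: unit set))"
    using A by simp_all
  show "mat_comp (A \<times> A \<times> A) g (mat_assoc A A A) ((a, b), c) z =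
      of_bool (a \<in> A \<and> b \<in> A \<and> c \<in> A) * g (a, b, c) z"
    unfolding mat_assoc_def by (subst comp_of_fun[OF fin(2)]) auto
  show "mat_comp ((A \<times> A) \<times> A) (mat_assoc A A A) f u (a, b, c) =
      of_bool (a \<in> A \<and> b \<in> A \<and> c \<in> A) * f u ((a, b), c)"
  proof (cases "a \<in> A \<and> b \<in> A \<and> c \<in> A")
    case True
    then show ?thesis unfolding mat_assoc_def
      using of_fun_comp[OF fin(1), of "\<lambda>((x, y), z). (x, y, z)" "((a, b), c)" f u]
      by (auto simp: inj_on_def)
  next
    case False
    then show ?thesis unfolding mat_assoc_def by (subst of_fun_comp_0) auto
  qed
  have "mat_comp (A \<times> A \<times> A) (mat_dagger (mat_assoc A A A)) f' u ((a, b), c) =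
      (\<Sum>p\<in>A \<times> A \<times> A. if p = (a, b, c) then f' u p else 0)"
    unfolding mat_comp_def
    by (intro sum.cong refl) (auto simp: mat_dagger_def mat_assoc_def mat_of_fun_def)
  then show "mat_comp (A \<times> A \<times> A) (mat_dagger (mat_assoc A A A)) f' u ((a, b), c) =
      of_bool (a \<in> A \<and> b \<in> A \<and> c \<in> A) * f' u (a, b, c)"
    using fin(2) by simp
  show "mat_comp (UNIV \<times> A) (mat_lunit A) fl u a = of_bool (a \<in> A) * fl u ((), a)"
  proof (cases "a \<in> A")
    case True
    then show ?thesis unfolding mat_lunit_def
      using of_fun_comp[OF fin(3), of snd "((), a)" fl u] by (auto simp: inj_on_def)
  next
    case False
    then show ?thesis unfolding mat_lunit_def by (subst of_fun_comp_0) auto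
  qed
  show "mat_comp (A \<times> UNIV) (mat_runit A) fr u a = of_bool (a \<in> A) * fr u (a, ())"
  proof (cases "a \<in> A")
    case True
    then show ?thesis unfolding mat_runit_def
      using of_fun_comp[OF fin(4), of fst "(a, ())" fr u] by (auto simp: inj_on_def)
  next
    case False
    then show ?thesis unfolding mat_runit_def by (subst of_fun_comp_0) auto
  qed
qed

context coherent_configuration
begin

lemma mult_apply:
  "config_mult X S (a, b) c = of_bool (a \<in> S \<and> b \<in> S \<and> c \<in> S) * real (N a b c)"
  by (simp add: config_mult_def)

lemma comult_apply: "config_comult X S a (b, c) = of_bool (a \<in> S \<and> b \<in> S \<and> c \<in> S) * D a b c"
  by (simp add: config_comult_def)

lemma unit_apply: "config_unit X S u a = of_bool (a \<in> E)"
  by (simp add: config_unit_def)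

lemma in_hom:
  "config_mult X S \<in> mat_hom (S \<times> S) S"
  "config_unit X S \<in> mat_hom UNIV S"
  "config_comult X S \<in> mat_hom S (S \<times> S)"
  "mat_dagger (config_unit X S) \<in> mat_hom S UNIV"
  by (auto simp: mat_hom_def config_mult_def config_unit_def config_comult_def mat_dagger_def
      unit_colors_def)

lemma axiom_assoc:
  "mat_comp (S \<times> S) (config_mult X S) (mat_tensor (config_mult X S) (mat_id S)) =
    mat_comp (S \<times> S) (config_mult X S)
      (mat_comp (S \<times> S \<times> S) (mat_tensor (mat_id S) (config_mult X S)) (mat_assoc S S S))"
  (is "?L = ?R")
proof -
  have "?L ((a, b), c) e = ?R ((a, b), c) e" for a b c e
  proof (cases "a \<in> S \<and> b \<in> S \<and> c \<in> S \<and> e \<in> S")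
    case True
    then show ?thesis
      by (simp add: mat_comp_assoc comp_tensor_id finite_S comp_structural mult_apply N_assoc)
  qed (auto simp: mat_comp_assoc comp_tensor_id finite_S comp_structural mult_apply)
  then show ?thesis by (simp add: fun_eq_iff)
qed

lemma axiom_unit:
  "mat_comp (S \<times> S) (config_mult X S) (mat_tensor (config_unit X S) (mat_id S)) = mat_lunit S"
  "mat_comp (S \<times> S) (config_mult X S) (mat_tensor (mat_id S) (config_unit X S)) = mat_runit S"
proof -
  have "mat_comp (S \<times> S) (config_mult X S) (mat_tensor (config_unit X S) (mat_id S)) (u, a) c =
      mat_lunit S (u, a) c" for u a c
  proof (cases "a \<in> S \<and> c \<in> S")
    case True
    then show ?thesis
      using N_left_unit_gen[of a c]
      by (auto simp: comp_tensor_id finite_S mult_apply unit_apply mat_lunit_def mat_of_fun_def)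
  qed (auto simp: comp_tensor_id finite_S mult_apply mat_lunit_def mat_of_fun_def)
  then show "mat_comp (S \<times> S) (config_mult X S) (mat_tensor (config_unit X S) (mat_id S)) =
      mat_lunit S" by (simp add: fun_eq_iff)
  have "mat_comp (S \<times> S) (config_mult X S) (mat_tensor (mat_id S) (config_unit X S)) (a, u) c =
      mat_runit S (a, u) c" for u a c
  proof (cases "a \<in> S \<and> c \<in> S")
    case True
    then show ?thesis
      using N_right_unit_gen[of a c]
      by (auto simp: comp_tensor_id finite_S mult_apply unit_apply mat_runit_def mat_of_fun_def)
  qed (auto simp: comp_tensor_id finite_S mult_apply mat_runit_def mat_of_fun_def)
  then show "mat_comp (S \<times> S) (config_mult X S) (mat_tensor (mat_id S) (config_unit X S)) =
      mat_runit S" by (simp add: fun_eq_iff)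
qed

lemma axiom_coassoc:
  "mat_comp ((S \<times> S) \<times> S) (mat_assoc S S S)
      (mat_comp (S \<times> S) (mat_tensor (config_comult X S) (mat_id S)) (config_comult X S)) =
    mat_comp (S \<times> S) (mat_tensor (mat_id S) (config_comult X S)) (config_comult X S)"
  (is "?L = ?R")
proof -
  have "?L a (b, c, g) = ?R a (b, c, g)" for a b c g
  proof (cases "a \<in> S \<and> b \<in> S \<and> c \<in> S \<and> g \<in> S")
    case True
    then have "?L a (b, c, g) = (\<Sum>p\<in>S. D a p g * D p b c)"
      unfolding comp_tensor_id[OF finite_S] comp_structural[OF finite_S]
      by (simp add: comult_apply)
    also have "\<dots> = (\<Sum>p\<in>S. D a b p * D p c g)"
      using True by (intro comult_coassoc) simp_all
    also have "\<dots> = ?R a (b, c, g)"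
      unfolding comp_tensor_id[OF finite_S] using True by (simp add: comult_apply)
    finally show ?thesis .
  qed (auto simp: comp_tensor_id finite_S comp_structural comult_apply)
  then show ?thesis by (simp add: fun_eq_iff)
qed

lemma axiom_counit:
  "mat_comp (UNIV \<times> S) (mat_lunit S)
    (mat_comp (S \<times> S) (mat_tensor (mat_dagger (config_unit X S)) (mat_id S)) (config_comult X S)) =
    mat_id S" (is "?L = _")
  "mat_comp (S \<times> UNIV) (mat_runit S)
    (mat_comp (S \<times> S) (mat_tensor (mat_id S) (mat_dagger (config_unit X S))) (config_comult X S)) =
    mat_id S" (is "?R = _")
proof -
  have "?L a c = mat_id S a c" for a c
  proof (cases "a \<in> S \<and> c \<in> S")
    case True
    then have "?L a c = (\<Sum>p\<in>S. D a p c * of_bool (p \<in> E))"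
      unfolding comp_tensor_id[OF finite_S] comp_structural[OF finite_S]
      by (simp add: comult_apply mat_dagger_def unit_apply)
    also have "\<dots> = of_bool (a = c)" using True by (intro counit_left) simp_all
    finally show ?thesis using True by (simp add: mat_id_apply eq_commute[of c a])
  qed (auto simp: comp_tensor_id finite_S comp_structural comult_apply mat_id_apply)
  then show "?L = mat_id S" by (simp add: fun_eq_iff)
  have "?R a c = mat_id S a c" for a c
  proof (cases "a \<in> S \<and> c \<in> S")
    case True
    then have "?R a c = (\<Sum>p\<in>S. D a c p * of_bool (p \<in> E))"
      unfolding comp_tensor_id[OF finite_S] comp_structural[OF finite_S]
      by (simp add: comult_apply mat_dagger_def unit_apply)
    also have "\<dots> = of_bool (a = c)" using True by (intro counit_right) simp_all
    finally show ?thesis using True by (simp add: mat_id_apply eq_commute[of c a])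
  qed (auto simp: comp_tensor_id finite_S comp_structural comult_apply mat_id_apply)
  then show "?R = mat_id S" by (simp add: fun_eq_iff)
qed

lemma axiom_frobenius:
  "mat_comp (S \<times> S \<times> S) (mat_tensor (mat_id S) (config_mult X S))
      (mat_comp ((S \<times> S) \<times> S) (mat_assoc S S S) (mat_tensor (config_comult X S) (mat_id S))) =
    mat_comp S (config_comult X S) (config_mult X S)" (is "?L = ?M")
  "mat_comp ((S \<times> S) \<times> S) (mat_tensor (config_mult X S) (mat_id S))
      (mat_comp (S \<times> S \<times> S) (mat_dagger (mat_assoc S S S))
        (mat_tensor (mat_id S) (config_comult X S))) =
    mat_comp S (config_comult X S) (config_mult X S)" (is "?R = _")
proof -
  have M: "?M (a, b) (c, e) = of_bool (a \<in> S \<and> b \<in> S \<and> c \<in> S \<and> e \<in> S) *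
      (\<Sum>p\<in>S. real (N a b p) * D p c e)" for a b c e
    by (auto simp: mat_comp_def mult_apply comult_apply)
  have "?L (a, b) (c, e) = ?M (a, b) (c, e)" for a b c e
  proof -
    have "?L (a, b) (c, e) = of_bool (c \<in> S) * (\<Sum>p\<in>S. \<Sum>q\<in>S.
        of_bool (b \<in> S \<and> q = b) * (config_comult X S a (c, p) * config_mult X S (p, q) e))"
      unfolding comp_tensor_id(4)[OF finite_S] sum.cartesian_product'
      by (auto simp: comp_structural[OF finite_S] mat_tensor_def mat_id_apply intro!: sum.cong)
    also have "\<dots> = of_bool (c \<in> S) * (\<Sum>p\<in>S.
        of_bool (b \<in> S) * (config_comult X S a (c, p) * config_mult X S (p, b) e))"
      by (simp only: sum_of_bool_delta[OF finite_S])
    also have "\<dots> = of_bool (a \<in> S \<and> b \<in> S \<and> c \<in> S \<and> e \<in> S) *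
        (\<Sum>p\<in>S. D a c p * real (N p b e))"
      by (auto simp: mult_apply comult_apply)
    also have "\<dots> = ?M (a, b) (c, e)"
      unfolding M
    proof (cases "a \<in> S \<and> b \<in> S \<and> c \<in> S \<and> e \<in> S")
      case True
      then show "of_bool (a \<in> S \<and> b \<in> S \<and> c \<in> S \<and> e \<in> S) * (\<Sum>p\<in>S. D a c p * real (N p b e)) =
          of_bool (a \<in> S \<and> b \<in> S \<and> c \<in> S \<and> e \<in> S) * (\<Sum>p\<in>S. real (N a b p) * D p c e)"
        by (simp only: frobenius_law_left)
    qed simp
    finally show ?thesis .
  qed
  then show "?L = ?M" by (simp add: fun_eq_iff)
  have "?R (a, b) (c, e) = ?M (a, b) (c, e)" for a b c e
  proof -
    have "?R (a, b) (c, e) = of_bool (e \<in> S) * (\<Sum>q\<in>S. \<Sum>p\<in>S.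
        of_bool (a \<in> S \<and> q = a) * (config_comult X S b (p, e) * config_mult X S (q, p) c))"
      unfolding comp_tensor_id(3)[OF finite_S] sum.cartesian_product'
      by (auto simp: comp_structural[OF finite_S] mat_tensor_def mat_id_apply intro!: sum.cong)
    also have "\<dots> = of_bool (e \<in> S) * (\<Sum>p\<in>S.
        of_bool (a \<in> S) * (config_comult X S b (p, e) * config_mult X S (a, p) c))"
      by (subst sum.swap) (simp only: sum_of_bool_delta[OF finite_S])
    also have "\<dots> = of_bool (a \<in> S \<and> b \<in> S \<and> c \<in> S \<and> e \<in> S) *
        (\<Sum>p\<in>S. D b p e * real (N a p c))"
      by (auto simp: mult_apply comult_apply)
    also have "\<dots> = ?M (a, b) (c, e)"
      unfolding M
    proof (cases "a \<in> S \<and> b \<in> S \<and> c \<in> S \<and> e \<in> S")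
      case True
      then show "of_bool (a \<in> S \<and> b \<in> S \<and> c \<in> S \<and> e \<in> S) * (\<Sum>p\<in>S. D b p e * real (N a p c)) =
          of_bool (a \<in> S \<and> b \<in> S \<and> c \<in> S \<and> e \<in> S) * (\<Sum>p\<in>S. real (N a b p) * D p c e)"
        by (simp only: frobenius_law_right)
    qed simp
    finally show ?thesis .
  qed
  then show "?R = ?M" by (simp add: fun_eq_iff)
qed

theorem config_frobenius_structure: "frobenius_structure (config_frobenius X S)"
  by (simp only: frobenius_structure_def Let_def config_frobenius_def frobenius_data.simps
      finite_S in_hom axiom_assoc axiom_unit axiom_coassoc axiom_counit axiom_frobenius simp_thms)

end

end

theory Submission
  imports Defs
begin

text \<open>
  By associativity \<open>\<nabla> \<circ> \<Delta>\<close> is left multiplication by the Casimir element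
  \<open>w = (\<Sum>b. b b\<inverse> / \<parallel>b\<inverse>\<parallel>)\<close>, so the structure is special iff \<open>w\<close> is a multiple of the unit, i.e. iff
  \<open>w\<close> is supported on unit colors. The coefficient of \<open>w\<close> at the color of \<open>(x, y)\<close> is positive iff
  \<open>(z, x)\<close> and \<open>(z, y)\<close> have the same color for some \<open>z\<close>; for \<open>x \<noteq> y\<close> this is excluded exactly by
  thinness. The pairing \<open>e\<^sup>\<dagger> \<circ> \<nabla>\<close> sends \<open>(a, a\<inverse>)\<close> to \<open>\<parallel>a\<parallel>\<close> and vanishes on all
  other pairs, so symmetry means \<open>\<parallel>a\<parallel> = \<parallel>a\<inverse>\<parallel>\<close>; now double count the pairs in \<open>a\<close> by their first
  and by their second components. Finally \<open>e\<^sup>\<dagger> \<circ> e\<close> is the number of unit colors.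
\<close>

context coherent_configuration
begin

section \<open>Unit colors and the extra condition\<close>

lemma unit_colorE:
  assumes "q \<in> E"
  obtains x where "x \<in> X" "(x, x) \<in> q"
proof -
  obtain x y where "(x, y) \<in> q" using color_nonempty unit_color_subset(2)[OF assms] by blast
  with unit_color_subset(1)[OF assms] have "x \<in> X" "(x, x) \<in> q" by blast+
  then show thesis by (rule that)
qed

lemma unit_color_at:
  assumes "x \<in> X"
  obtains q where "q \<in> E" "(x, x) \<in> q"
  using color_exists[OF assms assms] unit_color_iff by blast

lemma sum_unit_colors: "(\<Sum>q\<in>S. of_bool (q \<in> E) * f q) = (\<Sum>q\<in>E. f q :: real)"
proof -
  have "E \<subseteq> S" using unit_color_subset(2) by blast
  then show ?thesis
    by (intro sum.mono_neutral_cong_right finite_S) auto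
qed

text \<open>Unit colors partition the diagonal, so there is exactly one iff the diagonal is itself a
  color. If \<open>X\<close> is empty, both sides fail: there are no unit colors, and the empty
  relation is not a color.\<close>

lemma extra_iff: "extra (config_frobenius X S) \<longleftrightarrow> association_scheme X S"
proof -
  have "mat_comp S (mat_dagger (config_unit X S)) (config_unit X S) u v = real (card E)" for u v
    using sum_unit_colors[of "\<lambda>q. of_bool (q \<in> E)"]
    by (simp add: mat_comp_def mat_dagger_def unit_apply)
  then have "extra (config_frobenius X S) \<longleftrightarrow> card E = 1"
    by (simp add: extra_def config_frobenius_def fun_eq_iff mat_id_apply)
  also have "\<dots> \<longleftrightarrow> Id_on X \<in> S"
  proof
    assume "card E = 1"
    then obtain q where q: "E = {q}" by (auto simp: card_1_singleton_iff)
    then have "(x, x) \<in> q" if "x \<in> X" for x using unit_color_at[OF that] by auto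
    then have "Id_on X \<subseteq> q" by auto
    with q show "Id_on X \<in> S" using unit_color_subset[of q] by auto
  next
    assume Id: "Id_on X \<in> S"
    have "q = Id_on X" if q: "q \<in> E" for q
    proof -
      obtain x where "x \<in> X" "(x, x) \<in> q" using unit_colorE[OF q] .
      then show ?thesis using color_unique[OF unit_color_subset(2)[OF q] Id] by blast
    qed
    moreover have "Id_on X \<in> E" using Id by (simp add: unit_colors_def)
    ultimately have "E = {Id_on X}" by blast
    then show "card E = 1" by simp
  qed
  finally show ?thesis by (simp add: association_scheme_def)
qed

section \<open>The pairing of colors and the symmetric condition\<close>

lemma N_unit:
  assumes "a \<in> S" "b \<in> S" "q \<in> E"
  shows "N a b q = (if b = a\<inverse> \<and> q = color_source X S a then v a else 0)"
proof -
  obtain x where x: "x \<in> X" "(x, x) \<in> q" using unit_colorE[OF assms(3)] .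
  note N = N_eq[OF assms(1,2) unit_color_subset(2)[OF assms(3)] x(2)]
  show ?thesis
  \<comment> \<open>The number is evaluated at the diagonal point \<open>(x, x)\<close>. A single
    witness \<open>z\<close> puts \<open>(z, x)\<close> in both \<open>b\<close> and
    \<open>a\<inverse>\<close>, which forces them to be equal, and makes \<open>q\<close> the source
    of \<open>a\<close>.\<close>
  proof (cases "\<exists>z. (x, z) \<in> a \<and> (z, x) \<in> b")
    case True
    then obtain z where z: "(x, z) \<in> a" "(z, x) \<in> b" by blast
    have b: "b = a\<inverse>"
      using color_unique[OF assms(2) converse_closed[OF assms(1)] z(2)] z(1) by blast
    have "color_source X S a = q" using color_source_eq[OF assms(1,3) x(2) z(1)] .
    with b show ?thesis using N valency_eq[OF assms(1) z(1)] by simp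
  next
    case False
    then have "{z\<in>X. (x, z) \<in> a \<and> (z, x) \<in> b} = {}" by blast
    with N have "N a b q = 0" by (simp only: card.empty)
    \<comment> \<open>For \<open>b = a\<inverse>\<close> the number at the source is the valency by
      definition, hence positive.\<close>
    moreover have "q \<noteq> color_source X S a" if b: "b = a\<inverse>"
    proof
      assume q: "q = color_source X S a"
      have "v a = N a b q" by (simp add: valency_def q b)
      with \<open>N a b q = 0\<close> valency_pos[OF assms(1)] show False by simp
    qed
    ultimately show ?thesis by auto
  qed
qed

lemma color_source_unit_color:
  assumes "a \<in> S"
  shows "color_source X S a \<in> E"
proof -
  obtain x y where xy: "(x, y) \<in> a" using color_nonempty[OF assms] .
  then have "x \<in> X" using color_subset[OF assms] by blast
  then obtain q where q: "q \<in> E" "(x, x) \<in> q" by (rule unit_color_at)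
  show ?thesis unfolding color_source_eq[OF assms q xy] by (rule q(1))
qed

text \<open>By \<open>N_unit\<close>, only the source of \<open>a\<close> can contribute to the sum
  over unit colors.\<close>

lemma counit_mult:
  assumes "a \<in> S" "b \<in> S"
  shows "mat_comp S (mat_dagger (config_unit X S)) (config_mult X S) (a, b) u =
    of_bool (b = a\<inverse>) * real (v a)"
proof -
  have "mat_comp S (mat_dagger (config_unit X S)) (config_mult X S) (a, b) u =
      (\<Sum>q\<in>S. of_bool (q \<in> E) * real (N a b q))"
    using assms by (auto simp: mat_comp_def mat_dagger_def mult_apply unit_apply intro!: sum.cong)
  also have "\<dots> = (\<Sum>q\<in>E. if q = color_source X S a then of_bool (b = a\<inverse>) * real (v a) else 0)"
    unfolding sum_unit_colors by (rule sum.cong) (use N_unit[OF assms] in auto)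
  also have "\<dots> = of_bool (b = a\<inverse>) * real (v a)"
    using color_source_unit_color[OF assms(1)] finite_subset[OF _ finite_S, of E]
      unit_color_subset(2) by (subst sum.delta) auto
  finally show ?thesis .
qed

lemma symmetric_iff_valency:
  "symmetric (config_frobenius X S) \<longleftrightarrow> (\<forall>a\<in>S. v a = v (a\<inverse>))"
proof -
  let ?p = "mat_comp S (mat_dagger (config_unit X S)) (config_mult X S)"
  have swap: "mat_comp (S \<times> S) ?p (mat_sym S S) (a, b) u =
      of_bool (a \<in> S \<and> b \<in> S) * ?p (b, a) u" for a b u
    unfolding mat_sym_def using finite_S by (subst comp_of_fun) auto
  \<comment> \<open>Equality of matrices is equality of functions, so entries at non-colors have to
    be compared too.\<close>
  have outside: "?p (a, b) u = 0" if "a \<notin> S \<or> b \<notin> S" for a b u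
    using that by (auto simp: mat_comp_def mult_apply)
  have "symmetric (config_frobenius X S) \<longleftrightarrow>
      (\<forall>a b u. of_bool (a \<in> S \<and> b \<in> S) * ?p (b, a) u = ?p (a, b) u)"
    by (simp add: symmetric_def config_frobenius_def fun_eq_iff swap)
  also have "\<dots> \<longleftrightarrow> (\<forall>a\<in>S. \<forall>b\<in>S. \<forall>u. ?p (b, a) u = ?p (a, b) u)"
    using outside by (auto simp: of_bool_def)
  also have "\<dots> \<longleftrightarrow> (\<forall>a\<in>S. \<forall>b\<in>S. of_bool (a = b\<inverse>) * real (v b) = of_bool (b = a\<inverse>) * real (v a))"
    by (simp add: counit_mult)
  also have "\<dots> \<longleftrightarrow> (\<forall>a\<in>S. v a = v (a\<inverse>))"
  proof (intro iffI ballI)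
    fix a assume "\<forall>a\<in>S. \<forall>b\<in>S. of_bool (a = b\<inverse>) * real (v b) = of_bool (b = a\<inverse>) * real (v a)"
      and a: "a \<in> S"
    \<comment> \<open>The only informative instance is \<open>b = a\<inverse>\<close>.\<close>
    then have "of_bool (a = (a\<inverse>)\<inverse>) * real (v (a\<inverse>)) = of_bool (a\<inverse> = a\<inverse>) * real (v a)"
      using converse_closed by blast
    then show "v a = v (a\<inverse>)" by simp
  qed auto
  finally show ?thesis .
qed

lemma symmetric_iff: "symmetric (config_frobenius X S) \<longleftrightarrow> half_homogeneous X S"
proof -
  \<comment> \<open>\<open>p\<close> and \<open>q\<close> are the sources of \<open>a\<close> and of
    its converse, two relations of equal size.\<close>
  have cards: "card p * v a = card q * v (a\<inverse>)"
    if "a \<in> S" "(x, y) \<in> a" "p \<in> E" "(x, x) \<in> p" "q \<in> E" "(y, y) \<in> q" for a x y p q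
  proof -
    have "card a = card p * v a" by (rule card_source_valency[OF that(1,3,4,2)])
    moreover have "card (a\<inverse>) = card q * v (a\<inverse>)"
      using card_source_valency[OF converse_closed[OF that(1)] that(5,6), of x] that(2) by simp
    ultimately show ?thesis by (simp only: card_inverse)
  qed
  have "(\<forall>a\<in>S. v a = v (a\<inverse>)) \<longleftrightarrow> half_homogeneous X S"
  proof
    assume L: "\<forall>a\<in>S. v a = v (a\<inverse>)"
    show "half_homogeneous X S"
      unfolding half_homogeneous_def
    proof (intro ballI)
      fix p q assume pq: "p \<in> E" "q \<in> E"
      obtain x where x: "x \<in> X" "(x, x) \<in> p" using unit_colorE[OF pq(1)] .
      obtain y where y: "y \<in> X" "(y, y) \<in> q" using unit_colorE[OF pq(2)] .
      \<comment> \<open>Any two unit colors are joined by some color, so \<open>cards\<close>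
        compares their sizes once the positive valency is cancelled.\<close>
      obtain a where a: "a \<in> S" "(x, y) \<in> a" using color_exists[OF x(1) y(1)] .
      show "card p = card q"
        using cards[OF a pq(1) x(2) pq(2) y(2)] bspec[OF L a(1)] valency_pos[OF a(1)] by simp
    qed
  next
    assume R: "half_homogeneous X S"
    show "\<forall>a\<in>S. v a = v (a\<inverse>)"
    proof
      fix a assume a: "a \<in> S"
      obtain x y where xy: "(x, y) \<in> a" using color_nonempty[OF a] .
      then have X: "x \<in> X" "y \<in> X" using color_subset[OF a] by auto
      obtain p where p: "p \<in> E" "(x, x) \<in> p" using unit_color_at[OF X(1)] .
      obtain q where q: "q \<in> E" "(y, y) \<in> q" using unit_color_at[OF X(2)] .
      have "card p = card q" using R p(1) q(1) unfolding half_homogeneous_def by blast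
      moreover have "card p > 0"
        using p finite_color[OF unit_color_subset(2)[OF p(1)]] by (auto simp: card_gt_0_iff)
      ultimately show "v a = v (a\<inverse>)" using cards[OF a xy p q] by (metis mult_left_cancel less_not_refl)
    qed
  qed
  then show ?thesis by (simp only: symmetric_iff_valency)
qed

section \<open>The Casimir element and the special condition\<close>

definition casimir :: "'a rel \<Rightarrow> real" where
  "casimir c = (\<Sum>b\<in>S. 1 / real (v (b\<inverse>)) * real (N b (b\<inverse>) c))"

lemma mult_comult:
  assumes "a \<in> S" "d \<in> S"
  shows "mat_comp (S \<times> S) (config_mult X S) (config_comult X S) a d =
    (\<Sum>c\<in>S. casimir c * real (N c a d))"
proof -
  have "mat_comp (S \<times> S) (config_mult X S) (config_comult X S) a d =
      (\<Sum>b\<in>S. \<Sum>c\<in>S. D a b c * real (N b c d))"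
    unfolding mat_comp_def sum.cartesian_product'
    using assms by (intro sum.cong refl) (simp add: mult_apply comult_apply)
  also have "\<dots> = (\<Sum>b\<in>S. 1 / real (v (b\<inverse>)) * (\<Sum>c\<in>S. real (N b (b\<inverse>) c) * real (N c a d)))"
    \<comment> \<open>Associativity regroups \<open>(b b\<inverse>) a\<close> on the right as
      \<open>b (b\<inverse> a)\<close>.\<close>
    by (intro sum.cong refl, subst N_assoc)
      (simp_all add: assms converse_closed sum_distrib_left mult_ac)
  also have "\<dots> = (\<Sum>c\<in>S. casimir c * real (N c a d))"
    unfolding casimir_def sum_distrib_left sum_distrib_right
    by (subst sum.swap) (simp only: mult.assoc)
  finally show ?thesis .
qed

text \<open>Applying left multiplication by w to the unit recovers w; conversely, t times the unit
  acts as the scalar t. The same t serves both sides.\<close>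

lemma special_iff_casimir:
  "special (config_frobenius X S) \<longleftrightarrow> (\<exists>t\<ge>0. \<forall>c\<in>S. casimir c = t * of_bool (c \<in> E))"
proof -
  let ?m = "mat_comp (S \<times> S) (config_mult X S) (config_comult X S)"
  have outside: "?m a d = 0" if "a \<notin> S \<or> d \<notin> S" for a d
    using that by (auto simp: mat_comp_def mult_apply comult_apply intro!: sum.neutral)
  have "(?m = mat_scale t (mat_id S)) \<longleftrightarrow> (\<forall>c\<in>S. casimir c = t * of_bool (c \<in> E))" for t
  proof
    assume m: "?m = mat_scale t (mat_id S)"
    show "\<forall>c\<in>S. casimir c = t * of_bool (c \<in> E)"
    proof
      fix d assume d: "d \<in> S"
      \<comment> \<open>Expand w as w times the unit, then exchange the sums so that
        \<open>?m\<close> appears, applied to the unit.\<close>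
      have "casimir d = (\<Sum>c\<in>S. casimir c * of_bool (c = d))"
        using d finite_S by (simp add: of_bool_def if_distrib cong: if_cong)
      also have "\<dots> = (\<Sum>c\<in>S. casimir c * (\<Sum>q\<in>S. of_bool (q \<in> E) * real (N c q d)))"
        by (intro sum.cong refl) (simp only: N_right_unit_gen d)
      also have "\<dots> = (\<Sum>q\<in>S. of_bool (q \<in> E) * (\<Sum>c\<in>S. casimir c * real (N c q d)))"
        unfolding sum_distrib_left by (subst sum.swap) (simp only: mult_ac)
      also have "\<dots> = (\<Sum>q\<in>S. of_bool (q \<in> E) * ?m q d)"
        by (intro sum.cong refl) (simp only: mult_comult d)
      also have "\<dots> = (\<Sum>q\<in>S. if q = d then t * of_bool (d \<in> E) else 0)"
        unfolding m by (intro sum.cong refl) (auto simp: mat_scale_def mat_id_apply)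
      also have "\<dots> = t * of_bool (d \<in> E)" using d finite_S by simp
      finally show "casimir d = t * of_bool (d \<in> E)" .
    qed
  next
    assume w: "\<forall>c\<in>S. casimir c = t * of_bool (c \<in> E)"
    have "?m a d = mat_scale t (mat_id S) a d" for a d
    proof (cases "a \<in> S \<and> d \<in> S")
      case True
      then have "?m a d = (\<Sum>c\<in>S. casimir c * real (N c a d))" by (simp add: mult_comult)
      also have "\<dots> = t * (\<Sum>c\<in>S. of_bool (c \<in> E) * real (N c a d))"
        unfolding sum_distrib_left by (intro sum.cong refl) (use w in auto)
      also have "\<dots> = t * of_bool (a = d)" using True by (simp only: N_left_unit_gen)
      finally show ?thesis using True by (auto simp: mat_scale_def mat_id_apply)
    qed (auto simp: outside mat_scale_def mat_id_apply)
    then show "?m = mat_scale t (mat_id S)" by blast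
  qed
  then show ?thesis by (simp add: special_def config_frobenius_def)
qed

text \<open>The valency counts the endpoints at any start point of \<open>a\<close>, so one start
  point settles the converse direction.\<close>

lemma valency_eq_1_iff:
  assumes "a \<in> S"
  shows "v a = 1 \<longleftrightarrow> (\<forall>z x y. (z, x) \<in> a \<longrightarrow> (z, y) \<in> a \<longrightarrow> x = y)"
proof
  assume v: "v a = 1"
  show "\<forall>z x y. (z, x) \<in> a \<longrightarrow> (z, y) \<in> a \<longrightarrow> x = y"
  proof (intro allI impI)
    fix z x y assume xy: "(z, x) \<in> a" "(z, y) \<in> a"
    have "card {u\<in>X. (z, u) \<in> a} = 1" using valency_eq[OF assms xy(1)] v by simp
    then obtain u where u: "{u\<in>X. (z, u) \<in> a} = {u}" by (auto simp: card_1_singleton_iff)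
    have "x \<in> {u\<in>X. (z, u) \<in> a}" "y \<in> {u\<in>X. (z, u) \<in> a}"
      using xy color_subset[OF assms] by auto
    then show "x = y" unfolding u by simp
  qed
next
  assume inj: "\<forall>z x y. (z, x) \<in> a \<longrightarrow> (z, y) \<in> a \<longrightarrow> x = y"
  obtain z x where zx: "(z, x) \<in> a" using color_nonempty[OF assms] .
  then have "{u\<in>X. (z, u) \<in> a} = {x}" using inj color_subset[OF assms] by blast
  then show "v a = 1" using valency_eq[OF assms zx] by simp
qed

text \<open>With all valencies 1, the coefficient counts the \<open>z\<close> for which
  \<open>(x, z)\<close> and \<open>(y, z)\<close> have the same color: every \<open>z\<close> if
  \<open>x = y\<close>, none otherwise.\<close>

lemma casimir_thin:
  assumes "thin X S" "c \<in> S"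
  shows "casimir c = real (card X) * of_bool (c \<in> E)"
proof -
  obtain x y where xy: "(x, y) \<in> c" using color_nonempty[OF assms(2)] .
  then have X: "x \<in> X" "y \<in> X" using color_subset[OF assms(2)] by auto
  have v: "v a = 1" if "a \<in> S" for a using assms(1) that by (simp add: thin_def)
  have "casimir c = (\<Sum>b\<in>S. real (N b (b\<inverse>) c))"
    unfolding casimir_def by (intro sum.cong refl) (simp add: v converse_closed)
  also have "\<dots> = (\<Sum>b\<in>S. \<Sum>z\<in>X. of_bool ((x, z) \<in> b) * of_bool ((y, z) \<in> b))"
    by (intro sum.cong refl) (simp add: N_sum[OF _ _ assms(2) xy] converse_closed)
  also have "\<dots> = (\<Sum>z\<in>X. \<Sum>b\<in>S. of_bool ((x, z) \<in> b) * of_bool ((y, z) \<in> b))"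
    by (rule sum.swap)
  also have "\<dots> = (\<Sum>z\<in>X. of_bool (x = y))"
  proof (rule sum.cong[OF refl])
    fix z assume z: "z \<in> X"
    obtain g where g: "g \<in> S" "(x, z) \<in> g" using color_exists[OF X(1) z] .
    \<comment> \<open>The two pairs share their endpoint, not their start point, so thinness is used
      for the converse of \<open>g\<close>.\<close>
    have "(y, z) \<in> g \<longleftrightarrow> x = y"
      using g valency_eq_1_iff[of "g\<inverse>"] v[of "g\<inverse>"] converse_closed[OF g(1)] by blast
    then show "(\<Sum>b\<in>S. of_bool ((x, z) \<in> b) * of_bool ((y, z) \<in> b)) = (of_bool (x = y) :: real)"
      using sum_colors[OF X(1) z g, of "\<lambda>b. of_bool ((y, z) \<in> b)"] by simp
  qed
  also have "\<dots> = real (card X) * of_bool (x = y)" by simp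
  also have "x = y \<longleftrightarrow> c \<in> E"
    using unit_color_iff[OF assms(2)] unit_color_subset(1)[of c] xy by blast
  finally show ?thesis .
qed

text \<open>Two pairs of \<open>a\<close> with the same start point make the coefficient at the
  color \<open>c\<close> of \<open>(x, y)\<close> positive, so \<open>c\<close> must lie on the
  diagonal.\<close>

lemma thin_if_casimir:
  assumes "\<And>c. c \<in> S \<Longrightarrow> c \<notin> E \<Longrightarrow> casimir c = 0"
  shows "thin X S"
  unfolding thin_def
proof
  fix a assume a: "a \<in> S"
  note a' = converse_closed[OF a]
  have "x = y" if xy: "(z, x) \<in> a" "(z, y) \<in> a" for z x y
  proof -
    have X: "x \<in> X" "y \<in> X" "z \<in> X" using color_subset[OF a] xy by auto
    obtain c where c: "c \<in> S" "(x, y) \<in> c" using color_exists[OF X(1,2)] .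
    have "z \<in> {u\<in>X. (x, u) \<in> a\<inverse> \<and> (u, y) \<in> a}" using xy X(3) by simp
    then have "N (a\<inverse>) a c > 0"
      using N_eq[OF a' a c] finite_X by (auto simp: card_gt_0_iff)
    then have "1 / real (v a) * real (N (a\<inverse>) a c) > 0" using valency_pos[OF a] by simp
    \<comment> \<open>All summands are non-negative; this one is the term at
      \<open>b = a\<inverse>\<close>.\<close>
    moreover have "1 / real (v a) * real (N (a\<inverse>) a c) \<le> casimir c"
      unfolding casimir_def
      using member_le_sum[OF a', of "\<lambda>b. 1 / real (v (b\<inverse>)) * real (N b (b\<inverse>) c)"] finite_S
      by simp
    ultimately have "c \<in> E" using assms[OF c(1)] by fastforce
    then show "x = y" using unit_color_subset(1) c(2) by blast
  qed
  then show "v a = 1" using valency_eq_1_iff[OF a] by blast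
qed

lemma special_iff: "special (config_frobenius X S) \<longleftrightarrow> thin X S"
  unfolding special_iff_casimir
proof
  assume "\<exists>t\<ge>0. \<forall>c\<in>S. casimir c = t * of_bool (c \<in> E)"
  then show "thin X S" by (intro thin_if_casimir) auto
next
  assume "thin X S"
  \<comment> \<open>In the thin case the scalar is the number of points.\<close>
  then have "\<forall>c\<in>S. casimir c = real (card X) * of_bool (c \<in> E)" using casimir_thin by blast
  then show "\<exists>t\<ge>0. \<forall>c\<in>S. casimir c = t * of_bool (c \<in> E)" using of_nat_0_le_iff by blast
qed

end

theorem theorem3p3:
  fixes X :: "'a set" and S :: "'a rel set"
  assumes "coherent_configuration X S"
  shows "(special (config_frobenius X S) \<longleftrightarrow> thin X S) \<and>
    (symmetric (config_frobenius X S) \<longleftrightarrow> half_homogeneous X S) \<and>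
    (extra (config_frobenius X S) \<longleftrightarrow> association_scheme X S)"
proof -
  interpret coherent_configuration X S by (rule assms)
  show ?thesis using special_iff symmetric_iff extra_iff by blast
qed

end
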